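(* Let $a<-1$, $f(x,y)=\left(y\frac{x+a}{x-1},x+a-1\right)$, and let $R_0,R_1$ and the cones $\mathcal C^u_p$ be as in the context. If $p,\,f(p),\,f^2(p)\in(R_0\cup R_1)\cap\mathbf R^2$, then $Df^2_p$ maps $\mathcal C^u_p$ strictly inside $\mathcal C^u_{f^2(p)}$ (that is, nonzero vectors of $\mathcal C^u_p$ are mapped into $\mathcal C^u_{f^2(p)}\setminus\partial\mathcal C^u_{f^2(p)}$).
   Context: Fix a real number $a<-1$. Let $\overline{\mathbf R^2}=(\mathbf R\cup\{\infty\})^2$ and let $f(x,y)=\left(y\frac{x+a}{x-1},x+a-1\right)$, a birational map. Put $R_0=[1,\infty]\times[-\infty,-1]$ and $R_1=[-\infty,0]\times[0,\infty]$ in $\overline{\mathbf R^2}$. For $p\in\mathbf R^2$, let $L_p$ be the line through $(0,-1)$ and $p$, $H_p$ the horizontal line and $V_p$ the vertical line through $p$. For $p\in R_0\cap\mathbf R^2$, $\mathcal C^u_p$ is the closed cone of tangent vectors at $p$ swept out by rotating counterclockwise from $L_p$ to $H_p$; i.e. the vectors whose slope lies between the (nonpositive) slope of $L_p$ and $0$, inclusive. For $q\in R_1\cap\mathbf R^2$, $\mathcal C^u_q$ is the closed cone swept out by rotating counterclockwise from $V_q$ to $L_q$; i.e. the vectors that are vertical or whose slope is at most the (nonpositive) slope of $L_q$. *)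

theory Defs
  imports "HOL-Analysis.Analysis"
begin

text \<open>Only the finite parts of the rectangles $R_0$, $R_1$ are represented, since the
  cones live at finite points. The real function \<open>f_map a\<close> is the birational map on the
  set $x \neq 1$. On the line $x = 1$ (whose points, apart from the point of indeterminacy
  $(1,0)$, are mapped to infinity) division by zero gives it a spurious finite value, which
  lies outside $R_0 \cup R_1$ by \<open>f_map_pole\<close> below. Hence membership of \<open>f_map a p\<close> in
  \<open>R0 \<union> R1\<close> does mean that the true image is finite and lies there.\<close>

definition f_map :: "real \<Rightarrow> real \<times> real \<Rightarrow> real \<times> real" where
  "f_map a = (\<lambda>(x, y). (y * ((x + a) / (x - 1)), x + a - 1))"

definition R0 :: "(real \<times> real) set" where
  "R0 = {1..} \<times> {..-1}"

definition R1 :: "(real \<times> real) set" where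
  "R1 = {..0} \<times> {0..}"

lemma f_map_pole: "f_map a (1, y) \<notin> R0 \<union> R1" if "a < -1"
  using that by (auto simp: f_map_def R0_def R1_def)

text \<open>The slope of a non-vertical vector; callers treat vertical vectors separately.\<close>

definition slope :: "real \<times> real \<Rightarrow> real" where
  "slope v = snd v / fst v"

text \<open>The slope of the line $L_p$ through $(0,-1)$ and \<open>p\<close>, meaningful if \<open>fst p \<noteq> 0\<close>.\<close>

definition L_slope :: "real \<times> real \<Rightarrow> real" where
  "L_slope p = slope (p - (0, -1))"

text \<open>Cones consist of full lines through the origin, including the origin itself. If
  $p \in R_1$ has first coordinate $0$, then $L_p = V_p$ and the cone is the vertical line;
  likewise it is the horizontal line if $p \in R_0$ has second coordinate $-1$. The value
  outside \<open>R0 \<union> R1\<close> is a dummy.\<close>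

definition cone_u :: "real \<times> real \<Rightarrow> (real \<times> real) set" where
  "cone_u p =
    (if p \<in> R0 then {v. v = 0 \<or> (fst v \<noteq> 0 \<and> L_slope p \<le> slope v \<and> slope v \<le> 0)}
     else if p \<in> R1 then {v. fst v = 0 \<or> (fst p \<noteq> 0 \<and> slope v \<le> L_slope p)}
     else {})"

end

theory Submission imports Defs begin

text \<open>
  The map can be written as \<open>f(x, y) = (0, -1) + (x + a) (y / (x - 1), 1)\<close>. Hence it carries the
  pencil of lines through its point of indeterminacy \<open>(1, 0)\<close> to the pencil of lines through
  \<open>(0, -1)\<close>, which is the pencil that supplies the boundary lines \<open>L\<^sub>p\<close> of the cones; it also
  carries vertical lines to horizontal ones. So whether an image vector lies on the right side of
  \<open>L\<close> at \<open>f(p)\<close> is decided by the position of the original vector relative to the line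
  through \<open>p\<close> and \<open>(1, 0)\<close>, an exact identity (lemma \<open>pencil_transfer\<close>). That line is
  always disjoint from the cone at \<open>p\<close>, apart from the origin, so the condition on the side of
  \<open>L\<close> is gained strictly at every step.

  The other boundary line is horizontal over \<open>R\<^sub>0\<close> and vertical over \<open>R\<^sub>1\<close>. Image vectors are
  never vertical, by a direct estimate, and they are horizontal only if the original vector is
  vertical. The cones over \<open>R\<^sub>0\<close> contain no vertical vector, so there one step is already strict
  (\<open>Df_map_R0_strict\<close>). Over \<open>R\<^sub>1\<close> a vertical vector becomes horizontal, which is on the
  boundary of the cone at \<open>f(p) \<in> R\<^sub>0\<close>; all other vectors of the cone are mapped strictly inside
  (\<open>Df_map_R1\<close>, \<open>Df_map_R1_strict\<close>). Since \<open>f\<close> never maps \<open>R\<^sub>1\<close> to \<open>R\<^sub>1\<close>, every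
  orbit segment of two steps contains a step from \<open>R\<^sub>0\<close>. If this step is the second, it is strict;
  if it is the first, it removes the vertical vectors, and the second step is strict as well.
\<close>

section \<open>The cones as polynomial inequalities\<close>

text \<open>Over both rectangles the interior of the cone is given by the same two conditions: the slope
  is negative, and the determinant of \<open>p - (0, -1)\<close> and \<open>v\<close> has the sign of \<open>fst v\<close>. Passing
  from \<open>R\<^sub>0\<close> to \<open>R\<^sub>1\<close> reverses the inequality between slopes, but also the sign of
  \<open>fst p\<close>.\<close>

definition open_cone :: "real \<times> real \<Rightarrow> (real \<times> real) set" where
  "open_cone p = {v. fst v * snd v < 0 \<and>
     0 < fst v * (fst p * snd v - (snd p + 1) * fst v)}"

lemma open_open_cone: "open (open_cone p)"
  unfolding open_cone_def
  by (intro open_Collect_conj open_Collect_less continuous_intros)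

lemma slope_times_square: "fst v \<noteq> 0 \<Longrightarrow> slope v * (fst v)\<^sup>2 = fst v * snd v"
  by (simp add: slope_def power2_eq_square)

lemma le_slope_iff:
  assumes "fst v \<noteq> 0"
  shows "s \<le> slope v \<longleftrightarrow> s * (fst v)\<^sup>2 \<le> fst v * snd v"
    and "slope v \<le> s \<longleftrightarrow> fst v * snd v \<le> s * (fst v)\<^sup>2"
  using assms slope_times_square[of v, symmetric] by simp_all

lemma L_slope_eq: "L_slope p = (snd p + 1) / fst p"
  by (simp add: L_slope_def slope_def)

text \<open>Multiplying the slopes by \<open>(fst v)\<^sup>2\<close> over \<open>R\<^sub>0\<close>, and the inverse slopes by
  \<open>(snd v)\<^sup>2\<close> over \<open>R\<^sub>1\<close>, clears the denominators without a case distinction on signs. The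
  inverse slopes are also finite at the vertical vectors, which the cones over \<open>R\<^sub>1\<close>
  contain.\<close>

lemma cone_u_R0_iff:
  assumes "p \<in> R0"
  shows "v \<in> cone_u p - {0} \<longleftrightarrow> fst v \<noteq> 0 \<and> fst v * snd v \<le> 0 \<and>
    (snd p + 1) * (fst v)\<^sup>2 \<le> fst p * (fst v * snd v)"
proof -
  have x: "0 < fst p"
    using assms by (auto simp: R0_def)
  have "v \<in> cone_u p - {0} \<longleftrightarrow> fst v \<noteq> 0 \<and> L_slope p \<le> slope v \<and> slope v \<le> 0"
    using assms by (auto simp: cone_u_def)
  moreover have "L_slope p * r \<le> s \<longleftrightarrow> (snd p + 1) * r \<le> fst p * s" for r s
    using x by (simp add: L_slope_eq field_simps)
  ultimately show ?thesis
    by (auto simp: le_slope_iff)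
qed

lemma cone_u_R1_iff:
  assumes "p \<in> R1"
  shows "v \<in> cone_u p - {0} \<longleftrightarrow> snd v \<noteq> 0 \<and> fst v * snd v \<le> 0 \<and>
    fst p * (snd v)\<^sup>2 \<le> (snd p + 1) * (fst v * snd v)"
proof -
  obtain x y where p: "p = (x, y)" by (cases p)
  obtain u w where v: "v = (u, w)" by (cases v)
  have xy: "x \<le> 0" "0 \<le> y" and "p \<notin> R0"
    using assms p by (auto simp: R1_def R0_def)
  then have cone: "v \<in> cone_u p \<longleftrightarrow> u = 0 \<or> x \<noteq> 0 \<and> w / u \<le> (y + 1) / x"
    using assms by (simp add: cone_u_def L_slope_eq p v slope_def)
  show ?thesis
  proof (cases "u = 0")
    case True
    then show ?thesis
      using cone xy by (auto simp: p v zero_prod_def mult_nonpos_nonneg)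
  next
    case False
    have "x \<noteq> 0 \<and> w / u \<le> (y + 1) / x \<longleftrightarrow>
        w \<noteq> 0 \<and> u * w \<le> 0 \<and> x * w\<^sup>2 \<le> (y + 1) * (u * w)"
    proof
      assume l: "x \<noteq> 0 \<and> w / u \<le> (y + 1) / x"
      then have "(y + 1) / x < 0"
        using xy by (simp add: divide_pos_neg)
      then have neg: "w / u < 0" and ux: "x < 0"
        using l xy by auto
      then have uw: "u * w < 0"
        by (simp add: divide_less_0_iff mult_less_0_iff) blast
      have "(y + 1) \<le> x * (w / u)"
        using l ux by (simp add: field_simps)
      then have "x * (w / u) * (u * w) \<le> (y + 1) * (u * w)"
        using uw by (intro mult_right_mono_neg) auto
      then show "w \<noteq> 0 \<and> u * w \<le> 0 \<and> x * w\<^sup>2 \<le> (y + 1) * (u * w)"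
        using uw False by (auto simp: power2_eq_square)
    next
      assume r: "w \<noteq> 0 \<and> u * w \<le> 0 \<and> x * w\<^sup>2 \<le> (y + 1) * (u * w)"
      then have uw: "u * w < 0"
        using False by (simp add: order_less_le)
      then have "(y + 1) * (u * w) < 0"
        using xy by (simp add: mult_pos_neg)
      then have "x * w\<^sup>2 < 0"
        using r by linarith
      then have ux: "x < 0"
        using xy by (cases "x = 0") auto
      have "x * (w / u) * (u * w) \<le> (y + 1) * (u * w)"
        using r False by (simp add: power2_eq_square)
      then have "(y + 1) \<le> x * (w / u)"
        by (simp only: mult_le_cancel_right_neg[OF uw])
      then show "x \<noteq> 0 \<and> w / u \<le> (y + 1) / x"
        using ux by (simp add: field_simps)
    qed
    then show ?thesis
      using cone False by (simp add: p v zero_prod_def)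
  qed
qed

lemma open_cone_subset_cone_u:
  assumes "p \<in> R0 \<union> R1"
  shows "open_cone p \<subseteq> cone_u p - {0}"
proof
  fix v assume "v \<in> open_cone p"
  then have uw: "fst v * snd v < 0"
    and det: "(snd p + 1) * (fst v)\<^sup>2 < fst p * (fst v * snd v)"
    by (auto simp: open_cone_def algebra_simps power2_eq_square)
  then have nz: "fst v \<noteq> 0" "snd v \<noteq> 0"
    by auto
  show "v \<in> cone_u p - {0}"
  proof (cases "p \<in> R0")
    case True
    then show ?thesis
      using uw det nz by (subst cone_u_R0_iff) auto
  next
    case False
    then have "p \<in> R1"
      using assms by blast
    \<comment> \<open>The passage from slopes to inverse slopes: the determinant condition is multiplied by
      the negative number \<open>snd v / fst v\<close>.\<close>
    have "snd v / fst v < 0"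
      using uw by (auto simp: divide_less_0_iff mult_less_0_iff)
    from mult_strict_right_mono_neg[OF det this]
    have "fst p * (snd v)\<^sup>2 \<le> (snd p + 1) * (fst v * snd v)"
      using nz by (simp add: power2_eq_square)
    then show ?thesis
      using \<open>p \<in> R1\<close> uw nz by (subst cone_u_R1_iff) auto
  qed
qed

lemma open_cone_disjoint_frontier:
  assumes "p \<in> R0 \<union> R1"
  shows "open_cone p \<inter> frontier (cone_u p) = {}"
proof -
  have "open_cone p \<subseteq> interior (cone_u p)"
    using open_cone_subset_cone_u[OF assms] open_open_cone by (intro interior_maximal) auto
  then show ?thesis
    by (auto simp: frontier_def)
qed

section \<open>The derivative and the two pencils of lines\<close>

definition Df_map :: "real \<Rightarrow> real \<times> real \<Rightarrow> real \<times> real \<Rightarrow> real \<times> real" where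
  "Df_map a p v = (snd p * (- (1 + a) / (fst p - 1)\<^sup>2) * fst v
     + (fst p + a) / (fst p - 1) * snd v, fst v)"

lemma f_map_has_derivative:
  assumes "fst p \<noteq> 1"
  shows "(f_map a has_derivative Df_map a p) (at p)"
proof -
  have "((\<lambda>x. (x + a) / (x - 1)) has_real_derivative - (1 + a) / (fst p - 1)\<^sup>2) (at (fst p))"
    using assms by (auto intro!: derivative_eq_intros simp: power2_eq_square)
  from DERIV_compose_FDERIV[OF this has_derivative_fst[OF has_derivative_ident]]
  have g: "((\<lambda>q. (fst q + a) / (fst q - 1)) has_derivative
      (\<lambda>v. fst v * (- (1 + a) / (fst p - 1)\<^sup>2))) (at p)" .
  have "((\<lambda>q. (snd q * ((fst q + a) / (fst q - 1)), fst q + a - 1))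
      has_derivative Df_map a p) (at p)"
    by (rule has_derivative_eq_rhs[OF has_derivative_Pair[OF
          has_derivative_mult[OF has_derivative_snd[OF has_derivative_ident] g]
          has_derivative_diff[OF has_derivative_add[OF
            has_derivative_fst[OF has_derivative_ident] has_derivative_const] has_derivative_const]]])
      (auto simp: Df_map_def algebra_simps)
  moreover have "f_map a = (\<lambda>q. (snd q * ((fst q + a) / (fst q - 1)), fst q + a - 1))"
    by (auto simp: f_map_def)
  ultimately show ?thesis
    by simp
qed

text \<open>The determinant on the left compares \<open>Df v\<close> with the line through \<open>(0, -1)\<close> and
  \<open>f(p)\<close>, the one on the right compares \<open>v\<close> with the line through \<open>(1, 0)\<close> and \<open>p\<close>. The
  identity holds because \<open>f\<close> maps the second line to the first.\<close>

lemma pencil_transfer: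
  assumes "fst p \<noteq> 1"
  shows "fst (f_map a p) * snd (Df_map a p v) - (snd (f_map a p) + 1) * fst (Df_map a p v) =
    ((fst p + a) / (fst p - 1))\<^sup>2 * (snd p * fst v - (fst p - 1) * snd v)"
proof -
  obtain x y where p: "p = (x, y)" by (cases p)
  obtain u w where v: "v = (u, w)" by (cases v)
  define t where "t = x - 1"
  then have x: "x = t + 1" and "t \<noteq> 0"
    using assms p by auto
  then show ?thesis
    unfolding p v x by (simp add: f_map_def Df_map_def field_simps power2_eq_square)
qed

section \<open>One step from each rectangle\<close>

lemma fst_neq_1_if_f_map_in:
  assumes "a < -1" "f_map a p \<in> R0 \<union> R1"
  shows "fst p \<noteq> 1"
  using assms f_map_pole[of a "snd p"] by (cases p) auto

text \<open>The line through \<open>p\<close> and \<open>(1, 0)\<close> is steeper than \<open>L\<^sub>p\<close>: its slope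
  \<open>y / (x - 1)\<close> is smaller than the least slope \<open>(y + 1) / x\<close> in the cone at \<open>p\<close>. In terms of
  the factor \<open>g = (x + a) / (x - 1)\<close> in the first coordinate of \<open>f\<close>, this
  inequality also keeps \<open>Df v\<close> away from the vertical direction if \<open>g\<close> is negative; if
  \<open>g\<close> is nonnegative, the two terms of its first coordinate cannot cancel.\<close>

lemma Df_map_R0_strict:
  assumes a: "a < -1" and "p \<in> R0" and fp: "f_map a p \<in> R0 \<union> R1"
    and "v \<in> cone_u p - {0}"
  shows "Df_map a p v \<in> open_cone (f_map a p)"
proof -
  obtain x y where p: "p = (x, y)" by (cases p)
  obtain u w where v: "v = (u, w)" by (cases v)
  have x: "x > 1" and y: "y \<le> -1"
    using assms(2) fst_neq_1_if_f_map_in[OF a fp] by (auto simp: R0_def p)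
  have u: "u \<noteq> 0" and uw: "u * w \<le> 0" and L: "(y + 1) * u\<^sup>2 \<le> x * (u * w)"
    using assms(4) unfolding cone_u_R0_iff[OF assms(2)] by (auto simp: p v)
  have u2: "u\<^sup>2 > 0"
    using u by simp
  define g where "g = (x + a) / (x - 1)"
  define U where "U = y * (- (1 + a) / (x - 1)\<^sup>2) * u + g * w"
  have Df: "Df_map a p v = (U, u)"
    by (simp add: Df_map_def p v U_def g_def)
  \<comment> \<open>\<open>g = 0\<close> would give \<open>f(p) = (0, -1)\<close>, the base point of the image pencil.\<close>
  have "g \<noteq> 0"
    using fp x by (auto simp: g_def p f_map_def R0_def R1_def)
  have steep: "y * u\<^sup>2 < (x - 1) * (u * w)"
  proof -
    have "y * u\<^sup>2 < (y + 1) * u\<^sup>2"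
      using u2 by (simp add: algebra_simps)
    also have "\<dots> \<le> (x - 1) * (u * w)"
      using L uw by (simp add: algebra_simps)
    finally show ?thesis .
  qed
  have Uu: "U * u < 0"
  proof (cases "g \<ge> 0")
    case True
    have "y * (- (1 + a) / (x - 1)\<^sup>2) < 0"
      using y a x by (intro mult_neg_pos divide_pos_pos) auto
    then have "y * (- (1 + a) / (x - 1)\<^sup>2) * u\<^sup>2 < 0"
      using u2 by (simp only: mult_neg_pos)
    moreover have "g * (u * w) \<le> 0"
      using True uw by (rule mult_nonneg_nonpos)
    ultimately show ?thesis
      by (simp add: U_def algebra_simps power2_eq_square)
  next
    case False
    \<comment> \<open>Replacing the direction of \<open>v\<close> by that of the line through \<open>(1, 0)\<close> makes \<open>U u\<close>
      larger and simplifies it to \<open>y u\<^sup>2 / (x - 1)\<close>.\<close>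
    have "y * u\<^sup>2 / (x - 1) < u * w"
      using steep x by (simp add: field_simps)
    then have "g * (u * w) < g * (y * u\<^sup>2 / (x - 1))"
      using False by (intro mult_strict_left_mono_neg) auto
    then have "U * u < y * (- (1 + a) / (x - 1)\<^sup>2) * u\<^sup>2 + g * (y * u\<^sup>2 / (x - 1))"
      by (simp add: U_def algebra_simps power2_eq_square)
    also have "\<dots> = y * u\<^sup>2 * ((- (1 + a) + (x + a)) / (x - 1)\<^sup>2)"
    proof -
      have "y * (A / t\<^sup>2) * r + B / t * (y * r / t) = y * r * ((A + B) / t\<^sup>2)"
        for A B r t :: real
        by (simp add: power2_eq_square add_divide_distrib distrib_left mult_ac)
      then show ?thesis
        by (simp only: g_def)
    qed
    also have "\<dots> < 0"
      using y u2 x by (intro mult_neg_pos divide_pos_pos) (auto simp: mult_neg_pos)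
    finally show ?thesis .
  qed
  have "u * (y * u - (x - 1) * w) < 0"
    using steep by (simp add: algebra_simps power2_eq_square)
  \<comment> \<open>\<open>U\<close> and \<open>u\<close> have opposite signs, so \<open>u\<close> can be replaced by \<open>U\<close> here.\<close>
  then have "0 < U * (y * u - (x - 1) * w)"
    using Uu by (auto simp: mult_less_0_iff zero_less_mult_iff)
  then have "0 < g\<^sup>2 * (U * (y * u - (x - 1) * w))"
    using \<open>g \<noteq> 0\<close> by simp
  then have "0 < U * (fst (f_map a p) * u - (snd (f_map a p) + 1) * U)"
    using pencil_transfer[of p a v] x unfolding Df by (simp add: p v g_def mult.left_commute)
  then show ?thesis
    using Uu by (simp add: open_cone_def Df)
qed

lemma f_map_R1:
  assumes "a < -1" "p \<in> R1" "f_map a p \<in> R0 \<union> R1"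
  shows "f_map a p \<in> R0"
  using assms by (auto simp: f_map_def R0_def R1_def)

text \<open>Here \<open>-u / w \<le> -x / (y + 1)\<close> for \<open>v = (u, w)\<close> in the cone at \<open>p\<close>, so the two
  inequalities below follow from \<open>y / (y + 1) < 1\<close>. The first says that \<open>Df v\<close> is not vertical,
  the second that \<open>v\<close> lies on the vertical side of the line through \<open>p\<close> and \<open>(1, 0)\<close>.\<close>

lemma Df_map_R1_inequalities:
  assumes a: "a < -1" and "p \<in> R1" and "v \<in> cone_u p - {0}"
  shows "0 < fst (Df_map a p v) * snd v"
    and "0 < snd v * (snd p * fst v - (fst p - 1) * snd v)"
proof -
  obtain x y where p: "p = (x, y)" by (cases p)
  obtain u w where v: "v = (u, w)" by (cases v)
  have x: "x \<le> 0" and y: "0 \<le> y"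
    using assms(2) by (auto simp: R1_def p)
  have w: "w \<noteq> 0" and uw: "u * w \<le> 0" and L: "x * w\<^sup>2 \<le> (y + 1) * (u * w)"
    using assms(3) unfolding cone_u_R1_iff[OF assms(2)] by (auto simp: p v)
  have w2: "w\<^sup>2 > 0"
    using w by simp
  have yuw: "x * w\<^sup>2 \<le> y * (u * w)"
    using L uw by (simp add: algebra_simps)
  show "0 < snd v * (snd p * fst v - (fst p - 1) * snd v)"
    using yuw w2 by (simp add: p v algebra_simps power2_eq_square)
  have d: "(x - 1)\<^sup>2 > 0" "x - 1 \<noteq> 0"
    using x by auto
  have "0 < w\<^sup>2 * (((x - 1)\<^sup>2 - (1 + a)) / (x - 1)\<^sup>2)"
    using w2 d a by (intro mult_pos_pos divide_pos_pos) linarith+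
  also have "((x - 1)\<^sup>2 - (1 + a)) = - (1 + a) * x + (x + a) * (x - 1)"
    by (simp add: algebra_simps power2_eq_square)
  also have "w\<^sup>2 * ((- (1 + a) * x + (x + a) * (x - 1)) / (x - 1)\<^sup>2) =
      - (1 + a) / (x - 1)\<^sup>2 * (x * w\<^sup>2) + (x + a) / (x - 1) * w\<^sup>2"
  proof -
    have "r * ((C * x + B * t) / t\<^sup>2) = C / t\<^sup>2 * (x * r) + B / t * r"
      if "t \<noteq> 0" for B C r t :: real
      using that by (simp add: power2_eq_square field_simps)
    then show ?thesis
      using d by blast
  qed
  also have "\<dots> \<le> - (1 + a) / (x - 1)\<^sup>2 * (y * (u * w)) + (x + a) / (x - 1) * w\<^sup>2"
    using yuw a d by (intro add_right_mono mult_left_mono divide_nonneg_pos) auto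
  also have "\<dots> = fst (Df_map a p v) * snd v"
    by (simp add: p v Df_map_def algebra_simps power2_eq_square)
  finally show "0 < fst (Df_map a p v) * snd v" .
qed

lemma Df_map_R1_pencil_side:
  assumes a: "a < -1" and "p \<in> R1" and "v \<in> cone_u p - {0}"
  shows "0 < fst (Df_map a p v) * (fst (f_map a p) * snd (Df_map a p v)
    - (snd (f_map a p) + 1) * fst (Df_map a p v))"
proof -
  have x: "fst p \<le> 0"
    using assms(2) by (auto simp: R1_def)
  have "0 < fst (Df_map a p v) * (snd p * fst v - (fst p - 1) * snd v)"
    using Df_map_R1_inequalities[OF assms] by (auto simp: zero_less_mult_iff)
  moreover have "((fst p + a) / (fst p - 1))\<^sup>2 > 0"
    using x a by simp
  ultimately have "0 < ((fst p + a) / (fst p - 1))\<^sup>2 *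
      (fst (Df_map a p v) * (snd p * fst v - (fst p - 1) * snd v))"
    by (rule mult_pos_pos[rotated])
  then show ?thesis
    using x by (subst pencil_transfer) (auto simp only: mult.left_commute)
qed

lemma Df_map_R1:
  assumes a: "a < -1" and "p \<in> R1" and "f_map a p \<in> R0 \<union> R1"
    and "v \<in> cone_u p - {0}"
  shows "Df_map a p v \<in> cone_u (f_map a p) - {0}"
proof -
  have "fst v * snd v \<le> 0"
    using assms(4) unfolding cone_u_R1_iff[OF assms(2)] by blast
  then have "fst (Df_map a p v) * fst v \<le> 0"
    using Df_map_R1_inequalities(1)[OF a assms(2,4)]
    by (auto simp: zero_less_mult_iff mult_le_0_iff)
  moreover have "snd (Df_map a p v) = fst v"
    by (simp add: Df_map_def)
  moreover have "fst (Df_map a p v) \<noteq> 0"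
    using Df_map_R1_inequalities(1)[OF a assms(2,4)] by auto
  moreover note Df_map_R1_pencil_side[OF a assms(2,4)]
  ultimately show ?thesis
    unfolding cone_u_R0_iff[OF f_map_R1[OF assms(1-3)]]
    by (simp add: algebra_simps power2_eq_square)
qed

lemma Df_map_R1_strict:
  assumes a: "a < -1" and "p \<in> R1" and "v \<in> cone_u p - {0}" and "fst v \<noteq> 0"
  shows "Df_map a p v \<in> open_cone (f_map a p)"
proof -
  have "fst v * snd v < 0"
    using assms(3,4) unfolding cone_u_R1_iff[OF assms(2)] by (auto simp: order_less_le)
  then have "fst (Df_map a p v) * fst v < 0"
    using Df_map_R1_inequalities(1)[OF assms(1-3)]
    by (auto simp: zero_less_mult_iff mult_less_0_iff)
  moreover have "snd (Df_map a p v) = fst v"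
    by (simp add: Df_map_def)
  ultimately show ?thesis
    using Df_map_R1_pencil_side[OF assms(1-3)] by (simp add: open_cone_def)
qed

section \<open>Two steps\<close>

theorem theorem5p2:
  fixes a :: real and p :: "real \<times> real"
  assumes "a < -1"
    and "p \<in> R0 \<union> R1"
    and "f_map a p \<in> R0 \<union> R1"
    and "(f_map a ^^ 2) p \<in> R0 \<union> R1"
  shows "\<forall>v \<in> cone_u p - {0}.
    frechet_derivative (f_map a ^^ 2) (at p) v
      \<in> cone_u ((f_map a ^^ 2) p) - frontier (cone_u ((f_map a ^^ 2) p))"
proof
  fix v assume v: "v \<in> cone_u p - {0}"
  define q where "q = f_map a p"
  have sq: "f_map a ^^ 2 = f_map a \<circ> f_map a"
    by (simp add: numeral_2_eq_2)
  have q: "q \<in> R0 \<union> R1" and fq: "f_map a q \<in> R0 \<union> R1"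
    using assms(3,4) by (simp_all add: q_def sq)
  have "(f_map a \<circ> f_map a has_derivative Df_map a q \<circ> Df_map a p) (at p)"
    unfolding q_def
    using fst_neq_1_if_f_map_in[OF assms(1) assms(3)] fst_neq_1_if_f_map_in[OF assms(1) fq]
    by (intro diff_chain_at f_map_has_derivative) (simp_all add: q_def)
  then have D: "frechet_derivative (f_map a ^^ 2) (at p) v = Df_map a q (Df_map a p v)"
    unfolding sq by (simp add: frechet_derivative_at[symmetric])
  have "Df_map a q (Df_map a p v) \<in> open_cone (f_map a q)"
  proof (cases "p \<in> R0")
    case True
    then have strict: "Df_map a p v \<in> open_cone q"
      using Df_map_R0_strict assms(1,3) v by (simp add: q_def)
    then have cone: "Df_map a p v \<in> cone_u q - {0}" and "fst (Df_map a p v) \<noteq> 0"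
      using open_cone_subset_cone_u[OF q] by (auto simp: open_cone_def)
    then show ?thesis
      using Df_map_R0_strict[OF assms(1) _ fq cone] Df_map_R1_strict[OF assms(1) _ cone] q
      by blast
  next
    case False
    then have "p \<in> R1"
      using assms(2) by blast
    then have "q \<in> R0" "Df_map a p v \<in> cone_u q - {0}"
      unfolding q_def using f_map_R1 Df_map_R1 assms(1,3) v by blast+
    then show ?thesis
      using Df_map_R0_strict assms(1) fq by blast
  qed
  then show "frechet_derivative (f_map a ^^ 2) (at p) v
      \<in> cone_u ((f_map a ^^ 2) p) - frontier (cone_u ((f_map a ^^ 2) p))"
    using open_cone_subset_cone_u[OF fq] open_cone_disjoint_frontier[OF fq]
    unfolding D by (auto simp: sq q_def)
qed

end
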